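(* Let $(a^i_\eta)_{1\le i\le\nu,\,\eta\in H}$ be complex numbers with $a^i_\eta=0$ whenever $\eta\notin H_i$, and let $\rho^<$ be the associated map on $H$-decorated forests defined in the context. If a forest $F\in\mathcal F_H$ does not belong to $\mathcal F_H^+$, then $\rho^<(F)=0$.
   Context: Fix $\nu\ge1$, $x=(x_1,\dots,x_\nu)$, and let $e_i$ be the $i$-th canonical basis vector of $\mathbb{Z}^\nu$. For $1\le i\le\nu$ let $H_i=\{n-e_i:\ n\in\mathbb{N}^\nu,\ |n|\ge 2\}$ ($\mathbb N\ni0$, $|n|=n_1+\dots+n_\nu$) and $H=H_1\cup\dots\cup H_\nu$. Put $x^\eta=x_1^{\eta_1}\cdots x_\nu^{\eta_\nu}$. $\mathbb{C}[x,\partial_x]$ is the algebra of differential operators with polynomial coefficients, acting on $\mathbb{C}[[x]]$. $\mathcal T_H$ (resp. $\mathcal F_H$) is the set of non-planar rooted trees (resp. forests, i.e. commutative products of such trees, including the empty forest $\emptyset$) with vertices decorated by $H$. $B^+_\eta(F)$ is the tree obtained by joining the roots of $F$ to a new root decorated by $\eta$. $\|F\|$ is the sum of the decorations of all vertices of $F$. An admissible cut $c$ of a tree $T$ is a set of vertices of $T$ such that on the path from the root to an element of $c$ no other vertex of $c$ is encountered; $P^c(T)$ is the product of the subtrees of $T$ whose roots are in $c$ and $R^c(T)$ is the remaining tree once these subtrees have been removed (the empty cut, for which $R^c(T)=T$, is allowed). $\mathcal T_H^+$ is the set of trees $T$ such that for every admissible cut $c$ of $T$, all the nonempty trees $T_j$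 occurring in $(R^c(T),P^c(T))$ (that is, $R^c(T)$ and the tree factors of $P^c(T)$) satisfy $\|T_j\|\in H$. $\mathcal F_H^+$ is the set of forests all of whose trees belong to $\mathcal T_H^+$ (including $\emptyset$). Given coefficients $a^i_\eta$ (coming from a formal vector field with components $\sum_i a^i_\eta x^\eta x_i\partial_{x_i}$, or from a formal diffeomorphism $f_i(x)=x_i(1+\sum_{\eta\in H_i}a^i_\eta x^\eta)$), $\rho^<(F)\in\mathbb C[x,\partial_x]$ is defined for $F\in\mathcal F_H$ recursively by: $\rho^<(\emptyset)=\mathrm{Id}$; for a tree $T=B^+_\eta(F)$, $\rho^<(T)=\sum_{i=1}^\nu(\rho^<(F).(a^i_\eta x^\eta x_i))\partial_{x_i}$; for $F=T_1\cdots T_s$ with $s\ge2$ trees, consisting of $k$ distinct decorated trees with multiplicities $d_1,\dots,d_k$, $\rho^<(F)=\frac{1}{d_1!\cdots d_k!}\sum_{1\le i_1,\dots,i_s\le\nu}(\rho^<(T_1).x_{i_1})\cdots(\rho^<(T_s).x_{i_s})\partial_{x_{i_1}}\cdots\partial_{x_{i_s}}$. *)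

theory Defs
  imports "HOL-Analysis.Finite_Cartesian_Product" "HOL-Library.Multiset"
    "HOL-Library.Sublist" "HOL-Combinatorics.Permutations" Complex_Main
begin

section \<open>Formal power series in the variables indexed by a finite type\<close>

text \<open>
  The number of variables is the cardinality of the finite index type \<open>'n\<close>; exponents range over
  \<open>nat ^ 'n\<close>, and \<open>axis i 1\<close> is the \<open>i\<close>-th canonical basis vector.
\<close>

typedef (overloaded) 'n mfps = "UNIV :: (nat ^ 'n \<Rightarrow> complex) set"
  morphisms mcoeff Abs_mfps
  by simp

setup_lifting type_definition_mfps

lemma mfps_eqI: "(\<And>n. mcoeff f n = mcoeff g n) \<Longrightarrow> f = g"
  by transfer auto

lemma finite_vec_le: "finite {k :: nat ^ 'n. k \<le> n}"
proof -
  have "{k :: nat ^ 'n. k \<le> n} \<subseteq> vec_lambda ` (PiE UNIV (\<lambda>i. {..n $ i}))"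
  proof
    fix k :: "nat ^ 'n"
    assume "k \<in> {k. k \<le> n}"
    then have "vec_nth k \<in> PiE UNIV (\<lambda>i. {..n $ i})"
      by (auto simp: less_eq_vec_def)
    moreover have "k = vec_lambda (vec_nth k)"
      by simp
    ultimately show "k \<in> vec_lambda ` (PiE UNIV (\<lambda>i. {..n $ i}))"
      by blast
  qed
  then show ?thesis
    by (rule finite_subset) (auto intro!: finite_imageI finite_PiE)
qed

lemma finite_vec_add_eq: "finite {(k :: nat ^ 'n, l). k + l = n}"
proof (rule finite_subset)
  show "{(k, l). k + l = n} \<subseteq> {k. k \<le> n} \<times> {l. l \<le> n}"
    by (auto simp: less_eq_vec_def)
  show "finite ({k. k \<le> n} \<times> {l. l \<le> n})"
    by (intro finite_cartesian_product finite_vec_le)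
qed

instantiation mfps :: (finite) comm_ring_1
begin

lift_definition zero_mfps :: "'a mfps" is "\<lambda>_. 0" .
lift_definition one_mfps :: "'a mfps" is "\<lambda>n. if n = 0 then 1 else 0" .
lift_definition plus_mfps :: "'a mfps \<Rightarrow> 'a mfps \<Rightarrow> 'a mfps" is "\<lambda>f g n. f n + g n" .
lift_definition minus_mfps :: "'a mfps \<Rightarrow> 'a mfps \<Rightarrow> 'a mfps" is "\<lambda>f g n. f n - g n" .
lift_definition uminus_mfps :: "'a mfps \<Rightarrow> 'a mfps" is "\<lambda>f n. - f n" .
lift_definition times_mfps :: "'a mfps \<Rightarrow> 'a mfps \<Rightarrow> 'a mfps"
  is "\<lambda>f g n. \<Sum>(k, l)\<in>{(k, l). k + l = n}. f k * g l" .

instance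
proof
  fix f g h :: "'a mfps"
  show "f * g * h = f * (g * h)"
  proof (rule mfps_eqI)
    fix n
    let ?S = "\<lambda>n :: nat ^ 'a. {(k, l). k + l = n}"
    have "mcoeff (f * g * h) n =
        (\<Sum>x\<in>?S n. \<Sum>y\<in>?S (fst x). mcoeff f (fst y) * mcoeff g (snd y) * mcoeff h (snd x))"
      by (simp add: times_mfps.rep_eq sum_distrib_right case_prod_beta)
    also have "\<dots> = (\<Sum>(x, y)\<in>Sigma (?S n) (\<lambda>x. ?S (fst x)).
        mcoeff f (fst y) * mcoeff g (snd y) * mcoeff h (snd x))"
      by (rule sum.Sigma) (auto intro: finite_vec_add_eq)
    also have "\<dots> = (\<Sum>(x, y)\<in>Sigma (?S n) (\<lambda>x. ?S (snd x)).
        mcoeff f (fst x) * (mcoeff g (fst y) * mcoeff h (snd y)))"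
      by (rule sum.reindex_bij_witness
            [where i = "\<lambda>((p, r), (q, s)). ((p + q, s), (p, q))"
               and j = "\<lambda>((r, s), (p, q)). ((p, q + s), (q, s))"])
        (auto simp: algebra_simps)
    also have "\<dots> = (\<Sum>x\<in>?S n. \<Sum>y\<in>?S (snd x).
        mcoeff f (fst x) * (mcoeff g (fst y) * mcoeff h (snd y)))"
      by (rule sum.Sigma[symmetric]) (auto intro: finite_vec_add_eq)
    also have "\<dots> = mcoeff (f * (g * h)) n"
      by (simp add: times_mfps.rep_eq sum_distrib_left case_prod_beta)
    finally show "mcoeff (f * g * h) n = mcoeff (f * (g * h)) n" .
  qed
  show "f * g = g * f"
  proof (rule mfps_eqI)
    fix n
    show "mcoeff (f * g) n = mcoeff (g * f) n"
      unfolding times_mfps.rep_eq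
      by (rule sum.reindex_bij_witness[where i = prod.swap and j = prod.swap])
        (auto simp: algebra_simps)
  qed
  show "1 * f = f"
  proof (rule mfps_eqI)
    fix n
    have "mcoeff (1 * f) n = (\<Sum>(k, l)\<in>{(0, n)}. mcoeff 1 k * mcoeff f l)"
      unfolding times_mfps.rep_eq
      by (rule sum.mono_neutral_right)
        (auto simp: one_mfps.rep_eq finite_vec_add_eq split: if_splits)
    then show "mcoeff (1 * f) n = mcoeff f n"
      by (simp add: one_mfps.rep_eq)
  qed
  show "(f + g) * h = f * h + g * h"
    by (rule mfps_eqI)
      (simp add: times_mfps.rep_eq plus_mfps.rep_eq case_prod_beta sum.distrib[symmetric]
        algebra_simps)
  show "(0 :: 'a mfps) \<noteq> 1"
    by transfer (metis zero_neq_one)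
qed (transfer; auto)+

end

text \<open>
  \<open>c\<close> times the monomial with exponent \<open>\<zeta>\<close>. Exponents are integer vectors, as the decorations of
  trees are; an exponent with a negative entry does not belong to the power series ring and gives
  \<open>0\<close>. This case only occurs below together with a zero coefficient.
\<close>

lift_definition monomial :: "complex \<Rightarrow> int ^ 'n \<Rightarrow> 'n mfps"
  is "\<lambda>c \<zeta> n. if (\<chi> j. int (n $ j)) = \<zeta> then c else 0" .

abbreviation mconst :: "complex \<Rightarrow> 'n::finite mfps" where
  "mconst c \<equiv> monomial c 0"

abbreviation mvar :: "'n \<Rightarrow> 'n::finite mfps" where
  "mvar i \<equiv> monomial 1 (axis i 1)"

lift_definition partial :: "'n \<Rightarrow> 'n mfps \<Rightarrow> 'n::finite mfps"
  is "\<lambda>i f n. of_nat (n $ i + 1) * f (n + axis i 1)" .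

lemma partial_commute: "partial i (partial j f) = partial j (partial i f)"
  by transfer (auto simp: axis_def fun_eq_iff add.assoc add.commute algebra_simps)

section \<open>The algebra of differential operators with polynomial coefficients\<close>

definition is_polynomial :: "'n::finite mfps \<Rightarrow> bool" where
  "is_polynomial f \<longleftrightarrow> finite {n. mcoeff f n \<noteq> 0}"

lemma is_polynomial_monomial [simp]: "is_polynomial (monomial c \<zeta>)"
proof -
  have "{n. mcoeff (monomial c \<zeta>) n \<noteq> 0} \<subseteq> {\<chi> j. nat (\<zeta> $ j)}"
    by (auto simp: monomial.rep_eq vec_eq_iff) (metis nat_int)
  then show ?thesis
    unfolding is_polynomial_def by (rule finite_subset) simp
qed

lemma is_polynomial_0 [simp]: "is_polynomial 0"
  by (simp add: is_polynomial_def zero_mfps.rep_eq)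

lemma is_polynomial_1 [simp]: "is_polynomial 1"
proof -
  have "{n :: nat ^ 'n. mcoeff 1 n \<noteq> 0} \<subseteq> {0}"
    by (auto simp: one_mfps.rep_eq)
  then show ?thesis
    unfolding is_polynomial_def by (rule finite_subset) simp
qed

lemma is_polynomial_add:
  assumes "is_polynomial f" "is_polynomial g"
  shows "is_polynomial (f + g)"
proof -
  have "{n. mcoeff (f + g) n \<noteq> 0} \<subseteq> {n. mcoeff f n \<noteq> 0} \<union> {n. mcoeff g n \<noteq> 0}"
    by (auto simp: plus_mfps.rep_eq)
  then show ?thesis
    using assms unfolding is_polynomial_def by (meson finite_UnI finite_subset)
qed

lemma is_polynomial_mult:
  assumes "is_polynomial f" "is_polynomial g"
  shows "is_polynomial (f * g)"
proof -
  have "{n. mcoeff (f * g) n \<noteq> 0} \<subseteq>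
      (\<lambda>(k, l). k + l) ` ({n. mcoeff f n \<noteq> 0} \<times> {n. mcoeff g n \<noteq> 0})"
  proof
    fix n assume "n \<in> {n. mcoeff (f * g) n \<noteq> 0}"
    then obtain x where "x \<in> {(k, l). k + l = n}"
        and "(case x of (k, l) \<Rightarrow> mcoeff f k * mcoeff g l) \<noteq> 0"
      unfolding times_mfps.rep_eq mem_Collect_eq
      by (rule sum.not_neutral_contains_not_neutral) (rule that, simp_all)
    then show "n \<in> (\<lambda>(k, l). k + l) ` ({n. mcoeff f n \<noteq> 0} \<times> {n. mcoeff g n \<noteq> 0})"
      by (auto intro!: image_eqI[of _ _ x])
  qed
  then show ?thesis
    using assms unfolding is_polynomial_def by (meson finite_SigmaI finite_imageI finite_subset)
qed

lemma is_polynomial_partial: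
  assumes "is_polynomial f"
  shows "is_polynomial (partial i f)"
proof -
  have "(\<lambda>n. n + axis i 1) ` {n. mcoeff (partial i f) n \<noteq> 0} \<subseteq> {n. mcoeff f n \<noteq> 0}"
    by (auto simp: partial.rep_eq)
  then have "finite ((\<lambda>n. n + axis i 1) ` {n. mcoeff (partial i f) n \<noteq> 0})"
    using assms unfolding is_polynomial_def by (rule finite_subset)
  then show ?thesis
    unfolding is_polynomial_def by (rule finite_imageD) (auto simp: inj_on_def)
qed

lemma is_polynomial_prod:
  "(\<And>x. x \<in> A \<Longrightarrow> is_polynomial (f x)) \<Longrightarrow> is_polynomial (prod f A)"
  by (induction A rule: infinite_finite_induct) (auto intro: is_polynomial_mult)

text \<open>
  Differential operators are realised as operators on the power series ring. This action is
  faithful, so an element of the algebra vanishes iff the operator does.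
\<close>

inductive_set diff_ops :: "('n::finite mfps \<Rightarrow> 'n mfps) set" where
  mult: "is_polynomial p \<Longrightarrow> (\<lambda>g. p * g) \<in> diff_ops"
| deriv: "partial i \<in> diff_ops"
| add: "D \<in> diff_ops \<Longrightarrow> E \<in> diff_ops \<Longrightarrow> (\<lambda>g. D g + E g) \<in> diff_ops"
| comp: "D \<in> diff_ops \<Longrightarrow> E \<in> diff_ops \<Longrightarrow> (\<lambda>g. D (E g)) \<in> diff_ops"

lemma diff_ops_polynomial: "D \<in> diff_ops \<Longrightarrow> is_polynomial p \<Longrightarrow> is_polynomial (D p)"
  by (induction D arbitrary: p rule: diff_ops.induct)
    (auto intro: is_polynomial_mult is_polynomial_partial is_polynomial_add)

lemma diff_ops_mult: "is_polynomial p \<Longrightarrow> D \<in> diff_ops \<Longrightarrow> (\<lambda>g. p * D g) \<in> diff_ops"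
  using diff_ops.comp[OF diff_ops.mult] .

lemma diff_ops_0: "(\<lambda>g :: 'a::finite mfps. 0) \<in> diff_ops"
proof -
  have "(*) 0 = (\<lambda>g :: 'a mfps. 0)"
    by (simp add: fun_eq_iff)
  then show ?thesis
    using diff_ops.mult[of "0 :: 'a mfps"] by simp
qed

lemma diff_ops_id: "(\<lambda>g :: 'a::finite mfps. g) \<in> diff_ops"
proof -
  have "(*) 1 = (\<lambda>g :: 'a mfps. g)"
    by (simp add: fun_eq_iff)
  then show ?thesis
    using diff_ops.mult[of "1 :: 'a mfps"] by simp
qed

lemma diff_ops_sum:
  "(\<And>x. x \<in> A \<Longrightarrow> D x \<in> diff_ops) \<Longrightarrow> (\<lambda>g. \<Sum>x\<in>A. D x g) \<in> diff_ops"
  by (induction A rule: infinite_finite_induct) (auto intro: diff_ops_0 diff_ops.add)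

lemma diff_ops_foldr: "foldr partial is \<in> diff_ops"
proof (induction "is")
  case Nil
  then show ?case
    using diff_ops_id by (simp add: id_def)
next
  case (Cons i "is")
  then show ?case
    using diff_ops.comp[OF diff_ops.deriv] by (simp add: comp_def)
qed

section \<open>Decorations\<close>

definition Hi :: "'n::finite \<Rightarrow> (int ^ 'n) set" where
  "Hi i = {(\<chi> j. int (n $ j)) - axis i 1 | n :: nat ^ 'n. (\<Sum>j\<in>UNIV. n $ j) \<ge> 2}"

definition H :: "(int ^ 'n::finite) set" where
  "H = (\<Union>i. Hi i)"

section \<open>Non-planar decorated rooted trees and forests\<close>

datatype (decorations: 'd) tree = Bplus 'd "'d tree multiset"

type_synonym 'd forest = "'d tree multiset"

primrec dsum :: "'d::comm_monoid_add tree \<Rightarrow> 'd" where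
  "dsum (Bplus \<eta> F) = \<eta> + sum_mset (image_mset dsum F)"

definition T_H :: "(int ^ 'n::finite) tree set" where
  "T_H = {T. decorations T \<subseteq> H}"

definition F_H :: "(int ^ 'n::finite) forest set" where
  "F_H = {F. set_mset F \<subseteq> T_H}"

section \<open>Admissible cuts\<close>

text \<open>
  Two isomorphic siblings in a tree whose children form a multiset cannot be told apart, so in order
  to speak of sets of vertices we choose a planar representative of the tree; a vertex is then
  the list of child positions met on the path from the root to it.
\<close>

datatype 'd ptree = PB 'd "'d ptree list"

primrec nonplanar :: "'d ptree \<Rightarrow> 'd tree" where
  "nonplanar (PB \<eta> ts) = Bplus \<eta> (mset (map nonplanar ts))"

lemma nonplanar_surj: "\<exists>t. nonplanar t = T"
proof (induction T)
  case (Bplus \<eta> F)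
  have "\<exists>ts. mset (map nonplanar ts) = F"
    using Bplus
  proof (induction F)
    case (add T F)
    then obtain t ts where "nonplanar t = T" "mset (map nonplanar ts) = F"
      by force
    then have "mset (map nonplanar (t # ts)) = add_mset T F"
      by simp
    then show ?case
      by blast
  qed simp
  then show ?case
    by (metis nonplanar.simps)
qed

fun is_vertex :: "'d ptree \<Rightarrow> nat list \<Rightarrow> bool" where
  "is_vertex t [] \<longleftrightarrow> True"
| "is_vertex (PB \<eta> ts) (i # p) \<longleftrightarrow> i < length ts \<and> is_vertex (ts ! i) p"

definition vertices :: "'d ptree \<Rightarrow> nat list set" where
  "vertices t = {p. is_vertex t p}"

fun subtree_at :: "'d ptree \<Rightarrow> nat list \<Rightarrow> 'd ptree" where
  "subtree_at t [] = t"
| "subtree_at (PB \<eta> ts) (i # p) = subtree_at (ts ! i) p"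

lemma finite_vertices: "finite (vertices t)"
proof (induction t)
  case (PB \<eta> ts)
  have "vertices (PB \<eta> ts) \<subseteq> insert [] (\<Union>i<length ts. (#) i ` vertices (ts ! i))"
  proof
    fix p assume "p \<in> vertices (PB \<eta> ts)"
    then show "p \<in> insert [] (\<Union>i<length ts. (#) i ` vertices (ts ! i))"
      by (cases p) (auto simp: vertices_def)
  qed
  moreover have "finite (insert [] (\<Union>i<length ts. (#) i ` vertices (ts ! i)))"
    using PB by auto
  ultimately show ?case
    by (rule finite_subset)
qed

definition admissible_cut :: "'d ptree \<Rightarrow> nat list set \<Rightarrow> bool" where
  "admissible_cut t c \<longleftrightarrow>
     c \<subseteq> vertices t \<and> (\<forall>p\<in>c. \<forall>q\<in>vertices t. strict_prefix q p \<longrightarrow> q \<notin> c)"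

definition Pcut :: "nat list set \<Rightarrow> 'd ptree \<Rightarrow> 'd forest" where
  "Pcut c t = image_mset (\<lambda>p. nonplanar (subtree_at t p)) (mset_set c)"

text \<open>
  The remaining tree is returned as a forest: it is empty if the root is cut, and consists of a
  single tree otherwise.
\<close>

function Rcut :: "nat list set \<Rightarrow> 'd ptree \<Rightarrow> 'd forest" where
  "Rcut c (PB \<eta> ts) =
     (if [] \<in> c then {#} else {#Bplus \<eta> (\<Sum>i<length ts. Rcut {p. i # p \<in> c} (ts ! i))#})"
  by pat_completeness auto
termination
  by (relation "measure (\<lambda>(c, t). size t)")
    (auto simp: less_Suc_eq_le intro!: size_list_estimation'[OF nth_mem])

lemma Rcut_empty: "Rcut {} t = {#nonplanar t#}"
proof (induction t)
  case (PB \<eta> ts)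
  have "(\<Sum>i<length ts. Rcut {} (ts ! i)) = (\<Sum>i<length ts. {#nonplanar (ts ! i)#})"
    using PB by (intro sum.cong) auto
  also have "\<dots> = mset (map nonplanar ts)"
    by (induction ts rule: rev_induct) (auto simp: nth_append)
  finally show ?case
    by simp
qed

definition T_H_plus :: "(int ^ 'n::finite) tree set" where
  "T_H_plus = {T \<in> T_H. \<forall>t c. nonplanar t = T \<longrightarrow> admissible_cut t c \<longrightarrow>
     (\<forall>T' \<in># Rcut c t + Pcut c t. dsum T' \<in> H)}"

definition F_H_plus :: "(int ^ 'n::finite) forest set" where
  "F_H_plus = {F. set_mset F \<subseteq> T_H_plus}"

section \<open>The differential operator attached to a forest\<close>

text \<open>
  For at least two trees the operator is a sum over all words \<open>is\<close> of indices of length \<open>s\<close>; the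
  trees are enumerated by an arbitrarily chosen list, whose choice does not affect the result (lemma
  \<open>rho_forest_enum\<close> below).
\<close>

definition enum_forest :: "'d forest \<Rightarrow> 'd tree list" where
  "enum_forest F = (SOME Ts. mset Ts = F)"

lemma mset_enum_forest [simp]: "mset (enum_forest F) = F"
  unfolding enum_forest_def by (rule someI_ex) (rule ex_mset)

lemma length_enum_forest [simp]: "length (enum_forest F) = size F"
  by (metis mset_enum_forest size_mset)

lemma enum_forest_nth [simp]: "j < size F \<Longrightarrow> enum_forest F ! j \<in># F"
  by (metis length_enum_forest mset_enum_forest nth_mem_mset)

lemma finite_words [simp]: "finite {is :: 'n::finite list. length is = s}"
  using finite_lists_length_eq[of "UNIV :: 'n set" s] by simp

function (sequential)
  rho_tree :: "('n::finite \<Rightarrow> int ^ 'n \<Rightarrow> complex) \<Rightarrow> (int ^ 'n) tree \<Rightarrow> 'n mfps \<Rightarrow> 'n mfps" and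
  rho :: "('n \<Rightarrow> int ^ 'n \<Rightarrow> complex) \<Rightarrow> (int ^ 'n) forest \<Rightarrow> 'n mfps \<Rightarrow> 'n mfps" where
  "rho_tree a (Bplus \<eta> F) g = (\<Sum>i\<in>UNIV. rho a F (monomial (a i \<eta>) (\<eta> + axis i 1)) * partial i g)"
| "rho a F g =
    (if F = {#} then g
     else if size F = 1 then rho_tree a (enum_forest F ! 0) g
     else mconst (1 / (\<Prod>T\<in>set_mset F. fact (count F T))) *
       (\<Sum>is | length is = size F.
          (\<Prod>j<size F. rho_tree a (enum_forest F ! j) (mvar (is ! j))) * foldr partial is g))"
  by pat_completeness auto

lemma size_tree_le: "T \<in># F \<Longrightarrow> size T \<le> size_multiset size F"
  by (metis add.commute add_cancel_right_right le_add1 multi_member_split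
      size_multiset_add_mset le_Suc_eq le_add2 add_Suc_right Suc_leD)

termination
  by (relation "measure (\<lambda>x. case x of Inl (a, T, g) \<Rightarrow> 2 * size T
        | Inr (a, F, g) \<Rightarrow> 2 * size_multiset size F + 1)")
    (auto simp: less_Suc_eq_le nonempty_has_size intro!: size_tree_le)

declare rho_tree.simps [simp del] rho.simps [simp del]

lemma rho_empty [simp]: "rho a {#} = id"
  by (simp add: rho.simps fun_eq_iff)

lemma rho_singleton [simp]: "rho a {#T#} = rho_tree a T"
proof -
  have "enum_forest {#T#} = [T]"
    using mset_enum_forest[of "{#T#}"] by (simp only: mset_single_iff)
  then show ?thesis
    by (simp add: rho.simps fun_eq_iff)
qed

lemma foldr_partial_mset:
  "mset is = mset js \<Longrightarrow> foldr partial is g = foldr partial js g"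
  unfolding foldr_conv_fold
  by (rule fun_cong[OF fold_multiset_equiv]) (auto simp: partial_commute)

lemma rho_forest_enum:
  assumes "mset Ts = F" "length Ts \<ge> 2"
  shows "rho a F g = mconst (1 / (\<Prod>T\<in>set_mset F. fact (count F T))) *
     (\<Sum>is | length is = length Ts.
        (\<Prod>j<length Ts. rho_tree a (Ts ! j) (mvar (is ! j))) * foldr partial is g)"
proof -
  let ?s = "length Ts" and ?Es = "enum_forest F"
  have s: "size F = ?s"
    using assms by auto
  have "mset Ts = mset ?Es"
    using assms by simp
  then obtain \<pi> where \<pi>: "\<pi> permutes {..<?s}" and Es: "permute_list \<pi> Ts = ?Es"
    by (metis mset_eq_permutation length_enum_forest s)
  have inv\<pi>: "inv \<pi> permutes {..<?s}"
    using \<pi> by (rule permutes_inv)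
  have inv1: "permute_list \<pi> (permute_list (inv \<pi>) js) = js" if "length js = ?s" for js :: "'a list"
    using permute_list_compose[of \<pi> js "inv \<pi>"] \<pi> that
    by (simp only: permutes_inv_o permute_list_id)
  have inv2: "permute_list (inv \<pi>) (permute_list \<pi> js) = js" if "length js = ?s" for js :: "'a list"
    using permute_list_compose[of "inv \<pi>" js \<pi>] \<pi> inv\<pi> that
    by (simp only: permutes_inv_o permute_list_id)
  have eq: "(\<Prod>j<?s. rho_tree a (?Es ! j) (mvar (js ! j))) * foldr partial js g =
      (\<Prod>j<?s. rho_tree a (Ts ! j) (mvar (permute_list (inv \<pi>) js ! j))) *
        foldr partial (permute_list (inv \<pi>) js) g" if js: "length js = ?s" for js :: "'a list"
  proof -
    define ks where "ks = permute_list (inv \<pi>) js"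
    have ks: "length ks = ?s" "js = permute_list \<pi> ks"
      using js inv1 by (simp_all add: ks_def)
    have "(\<Prod>j<?s. rho_tree a (?Es ! j) (mvar (js ! j))) =
        (\<Prod>j<?s. rho_tree a (Ts ! \<pi> j) (mvar (ks ! \<pi> j)))"
      unfolding ks(2) Es[symmetric] using ks(1) \<pi>
      by (intro prod.cong) (simp_all add: permute_list_nth)
    also have "\<dots> = (\<Prod>j<?s. rho_tree a (Ts ! j) (mvar (ks ! j)))"
      using prod.permute[OF \<pi>, of "\<lambda>j. rho_tree a (Ts ! j) (mvar (ks ! j))"]
      by (simp add: comp_def)
    moreover have "foldr partial js g = foldr partial ks g"
      unfolding ks(2) using ks(1) \<pi> by (intro foldr_partial_mset) simp
    ultimately show ?thesis
      by (simp add: ks_def)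
  qed
  have "(\<Sum>is | length is = ?s.
          (\<Prod>j<?s. rho_tree a (?Es ! j) (mvar (is ! j))) * foldr partial is g) =
        (\<Sum>is | length is = ?s.
          (\<Prod>j<?s. rho_tree a (Ts ! j) (mvar (is ! j))) * foldr partial is g)"
    by (rule sum.reindex_bij_witness
        [where i = "permute_list \<pi>" and j = "permute_list (inv \<pi>)"])
      (simp_all only: mem_Collect_eq inv1 inv2 eq length_permute_list)
  then show ?thesis
    using assms s by (auto simp: rho.simps)
qed

lemma rho_diff_ops_aux:
  assumes "\<And>T. T \<in># F \<Longrightarrow> rho_tree a T \<in> diff_ops"
  shows "rho a F \<in> diff_ops"
proof -
  consider "F = {#}" | T where "F = {#T#}" | "size F \<ge> 2"
  proof -
    have "F = {#} \<or> (\<exists>T. F = {#T#}) \<or> size F \<ge> 2"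
      using size_1_singleton_mset[of F] nonempty_has_size[of F]
      by (cases "F = {#}"; cases "size F = 1"; simp)
    then show thesis
      using that by blast
  qed
  then show ?thesis
  proof cases
    case 1
    then show ?thesis
      using diff_ops_id by (simp add: id_def)
  next
    case 2
    then show ?thesis
      using assms by simp
  next
    case 3
    define D where "D = (\<lambda>is g. (\<Prod>j<size F. rho_tree a (enum_forest F ! j) (mvar (is ! j))) *
      foldr partial is g)"
    have "D is \<in> diff_ops" for "is"
      unfolding D_def
    proof (rule diff_ops_mult[OF is_polynomial_prod diff_ops_foldr])
      fix j assume "j \<in> {..<size F}"
      then show "is_polynomial (rho_tree a (enum_forest F ! j) (mvar (is ! j)))"
        by (intro diff_ops_polynomial[OF assms]) auto
    qed
    then have "(\<lambda>g. mconst (1 / (\<Prod>T\<in>set_mset F. fact (count F T))) *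
        (\<Sum>is | length is = size F. D is g)) \<in> diff_ops"
      by (rule diff_ops_mult[OF is_polynomial_monomial diff_ops_sum])
    moreover have "rho a F = (\<lambda>g. mconst (1 / (\<Prod>T\<in>set_mset F. fact (count F T))) *
        (\<Sum>is | length is = size F. D is g))"
      using 3 by (intro ext, subst rho.simps) (auto simp: D_def)
    ultimately show ?thesis
      by simp
  qed
qed

lemma rho_tree_diff_ops: "rho_tree a T \<in> diff_ops"
proof (induction T)
  case (Bplus \<eta> F)
  then have "rho a F \<in> diff_ops"
    by (rule rho_diff_ops_aux)
  then have "is_polynomial (rho a F (monomial (a i \<eta>) (\<eta> + axis i 1)))" for i
    by (rule diff_ops_polynomial) simp
  then have "(\<lambda>g. \<Sum>i\<in>UNIV. rho a F (monomial (a i \<eta>) (\<eta> + axis i 1)) * partial i g) \<in> diff_ops"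
    by (intro diff_ops_sum diff_ops_mult[OF _ diff_ops.deriv])
  moreover have "rho_tree a (Bplus \<eta> F) =
      (\<lambda>g. \<Sum>i\<in>UNIV. rho a F (monomial (a i \<eta>) (\<eta> + axis i 1)) * partial i g)"
    by (intro ext, rule rho_tree.simps)
  ultimately show ?case
    by simp
qed

lemma rho_diff_ops: "rho a F \<in> diff_ops"
  by (rule rho_diff_ops_aux) (rule rho_tree_diff_ops)

end

theory Submission
  imports Defs
begin

text \<open>
  Write \<open>e\<^sub>i\<close> for \<open>axis i 1\<close>. The operator of a tree \<open>T\<close> is a vector field whose \<open>i\<close>-th component is
  its value on \<open>x\<^sub>i\<close>, so it is nonzero iff some component is (\<open>rho_tree_vector_field\<close>). By
  the Leibniz-type sum defining the operator of a forest, a nonzero \<open>i\<close>-th component of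
  \<open>B\<^sup>+\<^sub>\<eta>(T\<^sub>1 \<dots> T\<^sub>s)\<close> comes with a word \<open>i\<^sub>1 \<dots> i\<^sub>s\<close> such that every \<open>T\<^sub>j\<close> has a nonzero
  \<open>i\<^sub>j\<close>-th component and \<open>\<partial>\<^bsub>i\<^sub>1\<^esub> \<dots> \<partial>\<^bsub>i\<^sub>s\<^esub> (x\<^sup>\<eta> x\<^sub>i) \<noteq> 0\<close>, that is,
  \<open>\<eta> + e\<^sub>i \<ge> e\<^bsub>i\<^sub>1\<^esub> + \<dots> + e\<^bsub>i\<^sub>s\<^esub>\<close> (\<open>rho_nonzero_word\<close>, \<open>foldr_partial_monomial_nonzero\<close>).

  The differentiated monomial must have room for all \<open>s\<close> branches at once, so it has room for any
  of their pieces too: by induction on \<open>T\<close>, cutting branches off leaves a tree \<open>R\<close> with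
  \<open>\<parallel>R\<parallel> + e\<^sub>i \<ge> 0\<close>, for if each remaining piece satisfies \<open>\<parallel>R\<^sub>j\<parallel> + e\<^bsub>i\<^sub>j\<^esub> \<ge> 0\<close>, then
  \<open>\<parallel>R\<parallel> + e\<^sub>i = \<eta> + e\<^sub>i + \<Sum>\<^sub>j \<parallel>R\<^sub>j\<parallel>\<close> is at least \<open>\<Sum>\<^sub>j (e\<^bsub>i\<^sub>j\<^esub> + \<parallel>R\<^sub>j\<parallel>)\<close>, where a branch
  that is cut at its root contributes \<open>e\<^bsub>i\<^sub>j\<^esub>\<close> alone (\<open>Rcut_weight_nonneg\<close>). The bound is on the
  weight of \<open>R\<close> only: the operator of \<open>R\<close> itself may vanish, because the sum over words may cancel.

  Every decoration has entries summing to at least \<open>1\<close>, and therefore so has \<open>\<parallel>R\<parallel>\<close>; together with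
  \<open>\<parallel>R\<parallel> + e\<^sub>i \<ge> 0\<close> this gives \<open>\<parallel>R\<parallel> \<in> H\<close>. The trees that are cut off are full subtrees; their
  operators are nonzero as well, and the empty cut gives their weights. So a tree whose operator is
  nonzero lies in \<open>T_H_plus\<close> (\<open>rho_tree_nonzero_T_H_plus\<close>), and a forest whose operator is nonzero
  consists of such trees.
\<close>

section \<open>Vector fields and iterated derivatives of monomials\<close>

lemma partial_mvar: "partial k (mvar i) = (if k = i then 1 else 0 :: 'n::finite mfps)"
proof (rule mfps_eqI)
  fix n :: "nat ^ 'n"
  have "(\<chi> j. int ((n + axis k 1) $ j)) = axis i 1 \<longleftrightarrow> n = 0 \<and> k = i"
  proof
    assume "(\<chi> j. int ((n + axis k 1) $ j)) = axis i 1"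
    then have eq: "int (n $ j) + (if j = k then 1 else 0) = (if j = i then 1 else 0)" for j
      by (auto simp: vec_eq_iff axis_def split: if_splits dest!: spec[of _ j])
    have "k = i"
      using eq[of k] by (auto split: if_splits)
    moreover have "n $ j = 0" for j
      using eq[of j] \<open>k = i\<close> by (auto split: if_splits)
    ultimately show "n = 0 \<and> k = i"
      by (simp add: vec_eq_iff)
  qed (auto simp: vec_eq_iff axis_def)
  then show "mcoeff (partial k (mvar i)) n = mcoeff (if k = i then 1 else 0) n"
    by (auto simp: partial.rep_eq monomial.rep_eq one_mfps.rep_eq zero_mfps.rep_eq)
qed

lemma rho_tree_mvar:
  "rho_tree a (Bplus \<eta> F) (mvar i) = rho a F (monomial (a i \<eta>) (\<eta> + axis i 1))"
  by (simp add: rho_tree.simps partial_mvar if_distrib cong: if_cong)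

lemma rho_tree_vector_field: "rho_tree a T g = (\<Sum>i\<in>UNIV. rho_tree a T (mvar i) * partial i g)"
proof (cases T)
  case (Bplus \<eta> F)
  then show ?thesis
    by (simp add: rho_tree_mvar) (simp add: rho_tree.simps)
qed

lemma mcoeff_foldr_partial_nonzero:
  "mcoeff (foldr partial is g) n \<noteq> 0 \<Longrightarrow> mcoeff g (n + (\<Sum>i\<leftarrow>is. axis i 1)) \<noteq> 0"
proof (induction "is" arbitrary: n)
  case (Cons i "is")
  then have "mcoeff (foldr partial is g) (n + axis i 1) \<noteq> 0"
    by (auto simp: partial.rep_eq)
  then show ?case
    using Cons.IH by (fastforce simp: add.assoc)
qed simp

lemma foldr_partial_monomial_nonzero:
  assumes "foldr partial is (monomial c \<zeta>) \<noteq> (0 :: 'n::finite mfps)"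
  shows "(\<Sum>i\<leftarrow>is. axis i 1 $ k) \<le> \<zeta> $ k"
proof -
  obtain n where "mcoeff (foldr partial is (monomial c \<zeta>)) n \<noteq> 0"
    using assms by (metis mfps_eqI zero_mfps.rep_eq)
  then have "mcoeff (monomial c \<zeta>) (n + (\<Sum>i\<leftarrow>is. axis i 1)) \<noteq> 0"
    by (rule mcoeff_foldr_partial_nonzero)
  then have "(\<chi> j. int ((n + (\<Sum>i\<leftarrow>is. axis i 1)) $ j)) = \<zeta>"
    by (auto simp: monomial.rep_eq split: if_splits)
  then have "\<zeta> $ k = int (n $ k) + int ((\<Sum>i\<leftarrow>is. axis i 1) $ k)"
    by auto
  moreover have "int ((\<Sum>i\<leftarrow>is. axis i 1) $ k) = (\<Sum>i\<leftarrow>is. axis i 1 $ k)"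
    by (induction "is") (auto simp: axis_def)
  ultimately show ?thesis
    by simp
qed

section \<open>Nonvanishing operators\<close>

text \<open>
  A nonzero sum over words has a nonzero summand, and a product can only be nonzero if each of its
  factors is. Stating this for every list of trees treats the three cases in the definition of
  \<open>rho\<close> alike; for a single tree the sum over words is the vector field expansion.
\<close>

lemma rho_nonzero_word:
  fixes a :: "'n::finite \<Rightarrow> int ^ 'n \<Rightarrow> complex"
  assumes "rho a (mset Ts) g \<noteq> 0"
  obtains "is" where "list_all2 (\<lambda>T i. rho_tree a T (mvar i) \<noteq> 0) Ts is"
    and "foldr partial is g \<noteq> 0"
proof -
  consider "Ts = []" | T where "Ts = [T]" | "length Ts \<ge> 2"
    by (cases Ts rule: list.exhaust; cases "tl Ts") auto
  then show thesis
  proof cases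
    case 1
    then show ?thesis
      using assms that[of "[]"] by simp
  next
    case (2 T)
    then have "(\<Sum>i\<in>UNIV. rho_tree a T (mvar i) * partial i g) \<noteq> 0"
      using assms rho_tree_vector_field[of a T g] by simp
    then obtain i where "rho_tree a T (mvar i) * partial i g \<noteq> 0"
      by (rule sum.not_neutral_contains_not_neutral)
    then show ?thesis
      using 2 by (intro that[of "[i]"]) auto
  next
    case 3
    have "(\<Sum>is | length is = length Ts.
        (\<Prod>j<length Ts. rho_tree a (Ts ! j) (mvar (is ! j))) * foldr partial is g) \<noteq> 0"
      using assms rho_forest_enum[OF refl 3, of a g] by auto
    then obtain "is" where len: "length is = length Ts"
      and nz: "(\<Prod>j<length Ts. rho_tree a (Ts ! j) (mvar (is ! j))) * foldr partial is g \<noteq> 0"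
      by (rule sum.not_neutral_contains_not_neutral) auto
    have "rho_tree a (Ts ! j) (mvar (is ! j)) \<noteq> 0" if "j < length Ts" for j
    proof
      assume "rho_tree a (Ts ! j) (mvar (is ! j)) = 0"
      then have "(\<Prod>j<length Ts. rho_tree a (Ts ! j) (mvar (is ! j))) = 0"
        using that prod.remove[of "{..<length Ts}" j "\<lambda>j. rho_tree a (Ts ! j) (mvar (is ! j))"]
        by simp
      then show False
        using nz by simp
    qed
    then show ?thesis
      using len nz by (intro that[of "is"]) (auto simp: list_all2_conv_all_nth)
  qed
qed

lemma subtree_at_component_nonzero:
  assumes "rho_tree a (nonplanar t) (mvar i) \<noteq> 0" "p \<in> vertices t"
  obtains j where "rho_tree a (nonplanar (subtree_at t p)) (mvar j) \<noteq> 0"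
proof -
  have "\<exists>j. rho_tree a (nonplanar (subtree_at t p)) (mvar j) \<noteq> 0"
    using assms
  proof (induction t p arbitrary: i rule: subtree_at.induct)
    case (2 \<eta> ts l p)
    then obtain "is" where
      "list_all2 (\<lambda>T i. rho_tree a T (mvar i) \<noteq> 0) (map nonplanar ts) is"
      by (auto simp: rho_tree_mvar simp flip: mset_map elim: rho_nonzero_word)
    then have "rho_tree a (nonplanar (ts ! l)) (mvar (is ! l)) \<noteq> 0"
      using 2 by (auto simp: vertices_def list_all2_conv_all_nth)
    then show ?case
      using 2 by (auto simp: vertices_def)
  qed auto
  then show thesis
    using that by blast
qed

section \<open>Weights of the pieces of a cut tree\<close>

abbreviation forest_weight :: "(int ^ 'n::finite) forest \<Rightarrow> int ^ 'n" where
  "forest_weight F \<equiv> sum_mset (image_mset dsum F)"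

lemma forest_weight_sum: "forest_weight (\<Sum>j\<in>A. G j) = (\<Sum>j\<in>A. forest_weight (G j))"
  by (induction A rule: infinite_finite_induct) auto

text \<open>
  The weight is taken of the forest \<open>Rcut c t\<close>, so that cutting at the root, which leaves nothing,
  needs no separate treatment in the induction: it gives \<open>0 + e\<^sub>i \<ge> 0\<close>.
\<close>

lemma Rcut_weight_nonneg:
  assumes "rho_tree a (nonplanar t) (mvar i) \<noteq> 0"
  shows "0 \<le> (forest_weight (Rcut c t) + axis i 1) $ k"
  using assms
proof (induction t arbitrary: i c)
  case (PB \<eta> ts)
  show ?case
  proof (cases "[] \<in> c")
    case True
    then show ?thesis
      by (simp add: axis_def)
  next
    case False
    let ?w = "\<lambda>j. forest_weight (Rcut {p. j # p \<in> c} (ts ! j))"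
    from PB.prems obtain "is" where
      nz: "list_all2 (\<lambda>T i. rho_tree a T (mvar i) \<noteq> 0) (map nonplanar ts) is" and
      der: "foldr partial is (monomial (a i \<eta>) (\<eta> + axis i 1)) \<noteq> 0"
      by (auto simp: rho_tree_mvar simp flip: mset_map elim: rho_nonzero_word)
    have len: "length is = length ts"
      using nz by (auto dest: list_all2_lengthD)
    have "0 \<le> (\<Sum>j<length ts. (?w j + axis (is ! j) 1) $ k)"
      using PB.IH nz by (intro sum_nonneg) (simp add: list_all2_conv_all_nth)
    also have "\<dots> = (\<Sum>j<length ts. ?w j $ k) + (\<Sum>j\<leftarrow>is. axis j 1 $ k)"
      using len by (simp add: sum.distrib sum_list_sum_nth atLeast0LessThan)
    also have "\<dots> \<le> (\<Sum>j<length ts. ?w j $ k) + (\<eta> + axis i 1) $ k"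
      using foldr_partial_monomial_nonzero[OF der] by simp
    also have "\<dots> = (forest_weight (Rcut c (PB \<eta> ts)) + axis i 1) $ k"
      using False by (simp add: forest_weight_sum)
    finally show ?thesis .
  qed
qed

lemma mem_Hi_iff:
  "\<eta> \<in> Hi i \<longleftrightarrow> (\<forall>k. 0 \<le> (\<eta> + axis i 1) $ k) \<and> 1 \<le> (\<Sum>k\<in>UNIV. \<eta> $ k)"
proof -
  have total: "(\<Sum>k\<in>UNIV. (\<eta> + axis i 1) $ k) = (\<Sum>k\<in>UNIV. \<eta> $ k) + 1"
    by (simp add: sum.distrib axis_def)
  show ?thesis
  proof
    assume "\<eta> \<in> Hi i"
    then obtain n :: "nat ^ 'a" where n: "\<eta> + axis i 1 = (\<chi> j. int (n $ j))"
      and deg: "2 \<le> (\<Sum>j\<in>UNIV. n $ j)"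
      by (auto simp: Hi_def)
    have "(\<Sum>k\<in>UNIV. (\<eta> + axis i 1) $ k) = int (\<Sum>j\<in>UNIV. n $ j)"
      by (simp only: n vec_lambda_beta of_nat_sum)
    then show "(\<forall>k. 0 \<le> (\<eta> + axis i 1) $ k) \<and> 1 \<le> (\<Sum>k\<in>UNIV. \<eta> $ k)"
      using total deg n by (simp only: vec_lambda_beta) linarith
  next
    assume *: "(\<forall>k. 0 \<le> (\<eta> + axis i 1) $ k) \<and> 1 \<le> (\<Sum>k\<in>UNIV. \<eta> $ k)"
    define n :: "nat ^ 'a" where "n = (\<chi> j. nat ((\<eta> + axis i 1) $ j))"
    have n: "int (n $ j) = (\<eta> + axis i 1) $ j" for j
      using * unfolding n_def by (simp only: vec_lambda_beta) simp
    have "int (\<Sum>j\<in>UNIV. n $ j) = (\<Sum>k\<in>UNIV. \<eta> $ k) + 1"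
      by (simp only: of_nat_sum n total)
    then have "2 \<le> (\<Sum>j\<in>UNIV. n $ j)"
      using * by linarith
    moreover have "\<eta> = (\<chi> j. int (n $ j)) - axis i 1"
      by (simp add: vec_eq_iff n)
    ultimately show "\<eta> \<in> Hi i"
      by (auto simp: Hi_def)
  qed
qed

lemma degree_dsum_pos:
  assumes "decorations T \<subseteq> H"
  shows "1 \<le> (\<Sum>k\<in>UNIV. dsum T $ k)"
  using assms
proof (induction T)
  case (Bplus \<eta> F)
  have "0 \<le> (\<Sum>k\<in>UNIV. forest_weight G $ k)" if "G \<subseteq># F" for G
    using that
  proof (induction G)
    case (add T G)
    then have "T \<in># F" "G \<subseteq># F"
      by (auto dest: mset_subset_eq_insertD subset_mset.less_imp_le)
    moreover from \<open>T \<in># F\<close> have "1 \<le> (\<Sum>k\<in>UNIV. dsum T $ k)"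
      using Bplus by (intro Bplus.IH) auto
    ultimately show ?case
      using add.IH by (simp add: sum.distrib)
  qed simp
  then have "0 \<le> (\<Sum>k\<in>UNIV. forest_weight F $ k)"
    by simp
  moreover have "1 \<le> (\<Sum>k\<in>UNIV. \<eta> $ k)"
    using Bplus.prems by (auto simp: H_def mem_Hi_iff)
  ultimately show ?case
    by (simp add: sum.distrib)
qed

lemma decorations_Rcut:
  "T' \<in># Rcut c t \<Longrightarrow> decorations T' \<subseteq> decorations (nonplanar t)"
proof (induction c t arbitrary: T' rule: Rcut.induct)
  case (1 c \<eta> ts)
  show ?case
  proof
    fix \<zeta> assume "\<zeta> \<in> decorations T'"
    moreover have "[] \<notin> c" "T' = Bplus \<eta> (\<Sum>l<length ts. Rcut {p. l # p \<in> c} (ts ! l))"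
      using "1.prems" by (auto split: if_splits)
    ultimately consider "\<zeta> = \<eta>" | l S where "l < length ts" "S \<in># Rcut {p. l # p \<in> c} (ts ! l)"
      "\<zeta> \<in> decorations S"
      by (auto simp: set_mset_sum)
    then show "\<zeta> \<in> decorations (nonplanar (PB \<eta> ts))"
    proof cases
      case 2
      then have "\<zeta> \<in> decorations (nonplanar (ts ! l))"
        using "1.IH"[OF \<open>[] \<notin> c\<close>, of l S] by auto
      then show ?thesis
        using 2 by auto
    qed simp
  qed
qed

lemma decorations_subtree_at:
  "p \<in> vertices t \<Longrightarrow> decorations (nonplanar (subtree_at t p)) \<subseteq> decorations (nonplanar t)"
  by (induction t p rule: subtree_at.induct) (fastforce simp: vertices_def)+

section \<open>Trees and forests with a nonzero operator\<close>

lemma dsum_Rcut_in_H: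
  assumes dec: "decorations (nonplanar t) \<subseteq> H"
    and nz: "rho_tree a (nonplanar t) (mvar i) \<noteq> 0"
    and T': "T' \<in># Rcut c t"
  shows "dsum T' \<in> H"
proof -
  have "Rcut c t = {#T'#}"
    using T' by (cases t) (auto split: if_splits)
  then have "0 \<le> (dsum T' + axis i 1) $ k" for k
    using Rcut_weight_nonneg[OF nz, of c k] by simp
  moreover have "1 \<le> (\<Sum>k\<in>UNIV. dsum T' $ k)"
    using dec decorations_Rcut[OF T'] by (intro degree_dsum_pos) blast
  ultimately show ?thesis
    by (auto simp: H_def mem_Hi_iff)
qed

lemma rho_tree_nonzero_T_H_plus:
  assumes T: "T \<in> T_H" and nz: "rho_tree a T (mvar i) \<noteq> 0"
  shows "T \<in> T_H_plus"
proof -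
  have "dsum T' \<in> H"
    if t: "nonplanar t = T" and c: "admissible_cut t c" and T': "T' \<in># Rcut c t + Pcut c t"
    for t c T'
  proof -
    have dec: "decorations (nonplanar t) \<subseteq> H"
      using T t by (simp add: T_H_def)
    consider "T' \<in># Rcut c t" | "T' \<in># Pcut c t"
      using T' by auto
    then show ?thesis
    proof cases
      case 1
      then show ?thesis
        using dsum_Rcut_in_H[OF dec] nz t by blast
    next
      case 2
      have "c \<subseteq> vertices t"
        using c by (simp add: admissible_cut_def)
      moreover from this have "finite c"
        by (rule finite_subset) (rule finite_vertices)
      ultimately obtain p where p: "p \<in> vertices t" "T' = nonplanar (subtree_at t p)"
        using 2 by (auto simp: Pcut_def)
      obtain j where "rho_tree a (nonplanar (subtree_at t p)) (mvar j) \<noteq> 0"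
        using subtree_at_component_nonzero nz t p(1) by blast
      moreover have "decorations (nonplanar (subtree_at t p)) \<subseteq> H"
        using decorations_subtree_at[OF p(1)] dec by blast
      ultimately show ?thesis
        using dsum_Rcut_in_H[of "subtree_at t p" a j T' "{}"] p(2) by (simp add: Rcut_empty)
    qed
  qed
  then show ?thesis
    using T by (simp add: T_H_plus_def)
qed

theorem theorem8:
  fixes a :: "'n::finite \<Rightarrow> int ^ 'n \<Rightarrow> complex"
    and F :: "(int ^ 'n) forest"
  assumes "\<And>i \<eta>. \<eta> \<in> H \<Longrightarrow> \<eta> \<notin> Hi i \<Longrightarrow> a i \<eta> = 0"
    and "F \<in> F_H"
    and "F \<notin> F_H_plus"
  shows "rho a F = (\<lambda>g. 0)"
proof (rule ccontr)
  assume "rho a F \<noteq> (\<lambda>g. 0)"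
  then obtain g where "rho a F g \<noteq> 0"
    by (auto simp: fun_eq_iff)
  moreover obtain Ts where Ts: "mset Ts = F"
    using ex_mset by blast
  ultimately obtain "is" where "list_all2 (\<lambda>T i. rho_tree a T (mvar i) \<noteq> 0) Ts is"
    by (auto elim: rho_nonzero_word)
  then have "\<exists>i. rho_tree a T (mvar i) \<noteq> 0" if "T \<in># F" for T
    using that unfolding Ts[symmetric] by (auto simp: list_all2_conv_all_nth in_set_conv_nth)
  moreover have "T \<in> T_H" if "T \<in># F" for T
    using assms(2) that by (auto simp: F_H_def)
  ultimately have "F \<in> F_H_plus"
    unfolding F_H_plus_def using rho_tree_nonzero_T_H_plus by blast
  then show False
    using assms(3) by contradiction
qed

end
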